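(* Consider a left-invariant Lorentzian problem on $G=\mathrm{Aff}_+(\mathbb R)$ given by a matrix $A=\begin{pmatrix}a&b\\c&d\end{pmatrix}$, $|A|>0$, $a\ge0$, with sectional curvature $K<0$. Let $q_0=\mathrm{Id}$. If $q_1\in F$, then there is no Lorentzian length maximizer connecting $q_0$ to $q_1$.
   Context: $G=\mathrm{Aff}_+(\mathbb R)=\{(x,y)\in\mathbb R^2: y>0\}$ with product $(x_2,y_2)\cdot(x_1,y_1)=(x_2+y_2x_1,\,y_2y_1)$ and identity $\mathrm{Id}=(0,1)$; left-invariant frame $X_1=y\,\partial_x$, $X_2=y\,\partial_y$. A real matrix $A=\begin{pmatrix}a&b\\c&d\end{pmatrix}$ with $|A|=ad-bc>0$ determines the left-invariant Lorentzian form $g(u_1X_1+u_2X_2)=-v_1^2+v_2^2$, $v_1=au_1+bu_2$, $v_2=cu_1+du_2$, with time orientation in which future directed nonspacelike vectors are those with $v_1\ge|v_2|$. Standing assumption of the paper: $a\ge0$. The sectional curvature is the constant $K=(c^2-a^2)/|A|^2$. A future directed nonspacelike curve is a Lipschitz curve $q:[0,t_1]\to G$ whose velocity is a.e. future directed nonspacelike; its Lorentzian length is $l(q)=\int_0^{t_1}\sqrt{v_1^2-v_2^2}\,dt$. A Lorentzian length maximizer is such a curve whose length equals the supremum of $l$ over all such curves with the same endpoints. $\lambda_1(x,y)=(c-a)x+(d-b)(y-1)$. For $K<0$ put $B=\left(\frac{d+b}{c+a},0\right)$, $\lambda_3(q)=\lambda_1(q)-\lambda_1(B)$ and $F=\{q\in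 G:\lambda_3(q)=0\}$ (one has $F\subset J^+(\mathrm{Id})$, the set of points reachable from $\mathrm{Id}$ by future directed nonspacelike curves). *)

theory Defs
  imports "HOL-Analysis.Analysis" "HOL-Algebra.Group"
begin

section \<open>The group of orientation-preserving affine maps of the line\<close>

definition Aff_plus :: "(real \<times> real) monoid" where
  "Aff_plus = \<lparr>carrier = {p. snd p > 0},
     mult = (\<lambda>p q. (fst p + snd p * fst q, snd p * snd q)),
     one = (0, 1)\<rparr>"

lemma group_Aff_plus: "group Aff_plus"
proof (rule groupI)
  fix p assume p: "p \<in> carrier Aff_plus"
  show "\<exists>q\<in>carrier Aff_plus. q \<otimes>\<^bsub>Aff_plus\<^esub> p = \<one>\<^bsub>Aff_plus\<^esub>"
    using p by (intro bexI[of _ "(- fst p / snd p, 1 / snd p)"]) (auto simp: Aff_plus_def)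
qed (auto simp: Aff_plus_def algebra_simps)

definition X1 :: "real \<times> real \<Rightarrow> real \<times> real" where
  "X1 p = (snd p, 0)"

definition X2 :: "real \<times> real \<Rightarrow> real \<times> real" where
  "X2 p = (0, snd p)"

lemma frame_left_invariant:
  "\<exists>D. ((\<lambda>r. p \<otimes>\<^bsub>Aff_plus\<^esub> r) has_derivative D) (at q) \<and>
       D (X1 q) = X1 (p \<otimes>\<^bsub>Aff_plus\<^esub> q) \<and> D (X2 q) = X2 (p \<otimes>\<^bsub>Aff_plus\<^esub> q)"
  by (rule exI[of _ "\<lambda>w. (snd p * fst w, snd p * snd w)"])
     (auto simp: Aff_plus_def X1_def X2_def intro!: derivative_eq_intros)

lemma frame_bracket:
  "\<exists>D1 D2. (X1 has_derivative D1) (at q) \<and> (X2 has_derivative D2) (at q) \<and>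
     D2 (X1 q) - D1 (X2 q) = - X1 q"
proof -
  have "(X1 has_derivative X1) (at q)" "(X2 has_derivative X2) (at q)"
    unfolding X1_def[abs_def] X2_def[abs_def] by (auto intro!: derivative_eq_intros)
  moreover have "X2 (X1 q) - X1 (X2 q) = - X1 q"
    by (simp add: X1_def X2_def prod_eq_iff)
  ultimately show ?thesis by blast
qed

text \<open>Components of a tangent vector \<open>w\<close> at \<open>p\<close> in the frame \<open>X1\<close>, \<open>X2\<close>.\<close>

definition frame_coords :: "real \<times> real \<Rightarrow> real \<times> real \<Rightarrow> real^2" where
  "frame_coords p w = vector [fst w / snd p, snd w / snd p]"

lemma frame_coords_iff:
  assumes "p \<in> carrier Aff_plus"
  shows "frame_coords p w = u \<longleftrightarrow> w = u $ 1 *\<^sub>R X1 p + u $ 2 *\<^sub>R X2 p"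
  using assms
  by (auto simp: frame_coords_def Aff_plus_def X1_def X2_def vec_eq_iff forall_2 prod_eq_iff
      field_simps)


section \<open>The left-invariant Lorentzian structure of a matrix\<close>

text \<open>Left-invariant vector fields are represented by their constant coordinates
  \<open>u :: real^2\<close> in the frame \<open>X1\<close>, \<open>X2\<close>; the vector \<open>(v\<^sub>1, v\<^sub>2)\<close> is \<open>A *v u\<close>.\<close>

definition lorentz_form :: "real^2^2 \<Rightarrow> real^2 \<Rightarrow> real^2 \<Rightarrow> real" where
  "lorentz_form A u w = - ((A *v u) $ 1 * (A *v w) $ 1) + (A *v u) $ 2 * (A *v w) $ 2"

definition future_nonspacelike :: "real^2^2 \<Rightarrow> real^2 \<Rightarrow> bool" where
  "future_nonspacelike A u \<longleftrightarrow> (A *v u) $ 1 \<ge> \<bar>(A *v u) $ 2\<bar>"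

text \<open>The Lie bracket of left-invariant vector fields is determined by \<open>[X1, X2] = - X1\<close>,
  see \<open>frame_bracket\<close>.\<close>

definition lie_bracket :: "real^2 \<Rightarrow> real^2 \<Rightarrow> real^2" where
  "lie_bracket u w = vector [u $ 2 * w $ 1 - u $ 1 * w $ 2, 0]"

text \<open>The Levi-Civita connection on left-invariant vector fields, given by the Koszul formula, in
  which the derivatives of the (constant) scalar products vanish.\<close>

definition levi_civita :: "real^2^2 \<Rightarrow> real^2 \<Rightarrow> real^2 \<Rightarrow> real^2" where
  "levi_civita A u w = (THE z. \<forall>s. 2 * lorentz_form A z s =
      lorentz_form A (lie_bracket u w) s - lorentz_form A (lie_bracket u s) w
      - lorentz_form A (lie_bracket w s) u)"

definition curvature_tensor :: "real^2^2 \<Rightarrow> real^2 \<Rightarrow> real^2 \<Rightarrow> real^2 \<Rightarrow> real^2" where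
  "curvature_tensor A u w s =
     levi_civita A u (levi_civita A w s) - levi_civita A w (levi_civita A u s)
     - levi_civita A (lie_bracket u w) s"

text \<open>In dimension two the tangent plane, spanned by \<open>X1\<close> and \<open>X2\<close>, is the only plane section.\<close>

definition sectional_curvature :: "real^2^2 \<Rightarrow> real" where
  "sectional_curvature A = (let e1 = axis 1 1; e2 = axis 2 1 in
     lorentz_form A (curvature_tensor A e1 e2 e2) e1
     / (lorentz_form A e1 e1 * lorentz_form A e2 e2 - (lorentz_form A e1 e2)\<^sup>2))"

lemma lorentz_form_expand:
  "lorentz_form A u w =
     ((A$2$1)\<^sup>2 - (A$1$1)\<^sup>2) * (u$1 * w$1) + (A$2$1 * A$2$2 - A$1$1 * A$1$2) * (u$1 * w$2 + u$2 * w$1)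
     + ((A$2$2)\<^sup>2 - (A$1$2)\<^sup>2) * (u$2 * w$2)"
  by (simp add: lorentz_form_def matrix_vector_mult_def sum_2 algebra_simps power2_eq_square)

lemma levi_civita_eq:
  assumes "det A \<noteq> 0"
  defines "E \<equiv> (A$2$1)\<^sup>2 - (A$1$1)\<^sup>2" and "M \<equiv> A$2$1 * A$2$2 - A$1$1 * A$1$2"
    and "N \<equiv> (A$2$2)\<^sup>2 - (A$1$2)\<^sup>2"
  defines "k1 \<equiv> \<lambda>u w :: real^2. - (E * u$1 * w$2 + M * u$2 * w$2)"
    and "k2 \<equiv> \<lambda>u w :: real^2. E * u$1 * w$1 + M * u$2 * w$1"
  shows "levi_civita A u w =
    vector [(M * k2 u w - N * k1 u w) / (det A)\<^sup>2, (M * k1 u w - E * k2 u w) / (det A)\<^sup>2]"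
    (is "_ = ?z")
proof -
  have D: "(det A)\<^sup>2 = M\<^sup>2 - E * N"
    by (simp add: det_2 E_def M_def N_def algebra_simps power2_eq_square)
  have D0: "M\<^sup>2 - E * N \<noteq> 0"
    using assms(1) D by (metis power_eq_0_iff)
  have g: "lorentz_form A p q = E * (p$1 * q$1) + M * (p$1 * q$2 + p$2 * q$1) + N * (p$2 * q$2)" for p q
    by (simp add: lorentz_form_expand E_def M_def N_def)
  have koszul: "lorentz_form A (lie_bracket u w) s - lorentz_form A (lie_bracket u s) w
      - lorentz_form A (lie_bracket w s) u = 2 * (k1 u w * s$1 + k2 u w * s$2)" for s
    by (simp add: g lie_bracket_def k1_def k2_def algebra_simps)
  have iff: "(\<forall>s. 2 * lorentz_form A z s = 2 * (k1 u w * s$1 + k2 u w * s$2)) \<longleftrightarrow>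
      E * z$1 + M * z$2 = k1 u w \<and> M * z$1 + N * z$2 = k2 u w" (is "?L \<longleftrightarrow> ?R") for z
  proof
    assume ?L
    from spec[OF this, of "axis 1 1"] spec[OF this, of "axis 2 1"] show ?R
      by (simp add: g axis_def)
  next
    assume r: ?R
    have "lorentz_form A z s = (E * z$1 + M * z$2) * s$1 + (M * z$1 + N * z$2) * s$2" for s
      by (simp add: g algebra_simps)
    with r show ?L by simp
  qed
  have sol: "E * z$1 + M * z$2 = x \<and> M * z$1 + N * z$2 = y \<longleftrightarrow>
      z = vector [(M * y - N * x) / (M\<^sup>2 - E * N), (M * x - E * y) / (M\<^sup>2 - E * N)]"
      (is "?L \<longleftrightarrow> ?R") for x y and z :: "real^2"
  proof
    assume l: ?L
    have "M * y - N * x = z$1 * (M\<^sup>2 - E * N)" "M * x - E * y = z$2 * (M\<^sup>2 - E * N)"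
      using l by (auto simp: algebra_simps power2_eq_square)
    with D0 show ?R by (simp add: vec_eq_iff forall_2)
  next
    assume r: ?R
    have "E * (M * y - N * x) + M * (M * x - E * y) = x * (M\<^sup>2 - E * N)"
      "M * (M * y - N * x) + N * (M * x - E * y) = y * (M\<^sup>2 - E * N)"
      by (auto simp: algebra_simps power2_eq_square)
    with D0 show ?L unfolding r
      by (simp add: add_divide_distrib[symmetric])
  qed
  show ?thesis
    unfolding levi_civita_def koszul iff sol D by simp
qed

lemma sectional_curvature_eq:
  assumes "det A \<noteq> 0"
  shows "sectional_curvature A = ((A$2$1)\<^sup>2 - (A$1$1)\<^sup>2) / (det A)\<^sup>2"
proof -
  define E M N where d: "E = (A$2$1)\<^sup>2 - (A$1$1)\<^sup>2" "M = A$2$1 * A$2$2 - A$1$1 * A$1$2"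
    "N = (A$2$2)\<^sup>2 - (A$1$2)\<^sup>2"
  have D: "(det A)\<^sup>2 = M\<^sup>2 - E * N"
    by (simp add: det_2 d algebra_simps power2_eq_square)
  have D0: "M\<^sup>2 - E * N \<noteq> 0"
    using assms(1) D by (metis power_eq_0_iff)
  have g: "lorentz_form A p q = E * (p$1 * q$1) + M * (p$1 * q$2 + p$2 * q$1) + N * (p$2 * q$2)" for p q
    by (simp add: lorentz_form_expand d)
  note lc = levi_civita_eq[OF assms, folded d, unfolded D]
  let ?e1 = "axis 1 1 :: real^2" and ?e2 = "axis 2 1 :: real^2"
  have e: "?e1 $ 1 = 1" "?e1 $ 2 = 0" "?e2 $ 1 = 0" "?e2 $ 2 = 1"
    by (simp_all add: axis_def)
  have g1: "lorentz_form A p ?e1 = E * p$1 + M * p$2" for p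
    by (simp add: g e)
  have "E * (M * k2 - N * k1) + M * (M * k1 - E * k2) = k1 * (M\<^sup>2 - E * N)" for k1 k2
    by (simp add: algebra_simps power2_eq_square)
  with D0 have koszul: "lorentz_form A (levi_civita A u w) ?e1 = - (E * u$1 * w$2 + M * u$2 * w$2)" for u w
    unfolding g1 lc by (simp add: add_divide_distrib[symmetric] del: mult_minus_right)
  have diff: "lorentz_form A (p - q) ?e1 = lorentz_form A p ?e1 - lorentz_form A q ?e1" for p q
    by (simp add: g1 algebra_simps)
  have n2: "levi_civita A ?e2 ?e2 $ 2 = - (M * M) / (M\<^sup>2 - E * N)"
    "levi_civita A ?e1 ?e2 $ 2 = - (M * E) / (M\<^sup>2 - E * N)"
    by (simp_all add: lc e)
  have "lorentz_form A (curvature_tensor A ?e1 ?e2 ?e2) ?e1 = - E"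
    unfolding curvature_tensor_def diff koszul
    by (simp add: e n2 lie_bracket_def)
  moreover have "lorentz_form A ?e1 ?e1 * lorentz_form A ?e2 ?e2 - (lorentz_form A ?e1 ?e2)\<^sup>2
      = - (M\<^sup>2 - E * N)"
    by (simp add: g e)
  moreover have "- x / - y = x / y" for x y :: real
    by simp
  ultimately show ?thesis
    by (simp only: sectional_curvature_def Let_def D d(1)[symmetric])
qed


section \<open>Curves, length and maximizers\<close>

definition curve_velocity :: "real \<Rightarrow> (real \<Rightarrow> real \<times> real) \<Rightarrow> real \<Rightarrow> real^2" where
  "curve_velocity t1 q t = frame_coords (q t) (vector_derivative q (at t within {0..t1}))"

text \<open>A curve \<open>q : [0, t1] \<rightarrow> G\<close> is a total function of which only the values on \<open>{0..t1}\<close> matter.\<close>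

definition future_nonspacelike_curve :: "real^2^2 \<Rightarrow> real \<Rightarrow> (real \<Rightarrow> real \<times> real) \<Rightarrow> bool" where
  "future_nonspacelike_curve A t1 q \<longleftrightarrow>
     0 < t1 \<and> q \<in> {0..t1} \<rightarrow> carrier Aff_plus \<and> (\<exists>L. L-lipschitz_on {0..t1} q) \<and>
     (AE t in lebesgue_on {0..t1}. q differentiable (at t within {0..t1}) \<and>
        future_nonspacelike A (curve_velocity t1 q t))"

definition lorentz_length :: "real^2^2 \<Rightarrow> real \<Rightarrow> (real \<Rightarrow> real \<times> real) \<Rightarrow> real" where
  "lorentz_length A t1 q = (LINT t|lebesgue_on {0..t1}.
     sqrt (((A *v curve_velocity t1 q t) $ 1)\<^sup>2 - ((A *v curve_velocity t1 q t) $ 2)\<^sup>2))"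

text \<open>The supremum is taken in the extended reals, since it may be infinite.\<close>

definition lorentz_length_maximizer :: "real^2^2 \<Rightarrow> real \<Rightarrow> (real \<Rightarrow> real \<times> real) \<Rightarrow> bool" where
  "lorentz_length_maximizer A t1 q \<longleftrightarrow> future_nonspacelike_curve A t1 q \<and>
     ereal (lorentz_length A t1 q) =
       (SUP (s, r) \<in> {(s, r). future_nonspacelike_curve A s r \<and> r 0 = q 0 \<and> r s = q t1}.
          ereal (lorentz_length A s r))"


section \<open>The exceptional set\<close>

definition lambda1 :: "real^2^2 \<Rightarrow> real \<times> real \<Rightarrow> real" where
  "lambda1 A p = (A$2$1 - A$1$1) * fst p + (A$2$2 - A$1$2) * (snd p - 1)"

definition B_point :: "real^2^2 \<Rightarrow> real \<times> real" where
  "B_point A = ((A$2$2 + A$1$2) / (A$2$1 + A$1$1), 0)"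

definition lambda3 :: "real^2^2 \<Rightarrow> real \<times> real \<Rightarrow> real" where
  "lambda3 A p = lambda1 A p - lambda1 A (B_point A)"

definition F_set :: "real^2^2 \<Rightarrow> (real \<times> real) set" where
  "F_set A = {p \<in> carrier Aff_plus. lambda3 A p = 0}"

end

theory Submission
  imports Defs "HOL-Real_Asymp.Real_Asymp"
begin

text \<open>In null coordinates the Lorentzian plane becomes explicit. There are two affine functions
  \<open>s\<close> and \<open>z\<close> on the group, with \<open>s + z = y\<close>, such that a curve is future directed nonspacelike
  iff \<open>s\<close> is nonincreasing and \<open>z\<close> is nondecreasing along it, and its length is a fixed multiple of
  \<open>\<integral> sqrt (- s' z') / (s + z) dt\<close>. The identity is the point \<open>s = 1\<close>, \<open>z = 0\<close>, and the exceptional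
  set is the half-line \<open>s = 0\<close>, \<open>z > 0\<close>.

  The function \<open>arctan (sqrt (z / s))\<close> calibrates the problem: by the inequality of the arithmetic and
  the geometric mean its derivative along a curve is at least the integrand, with equality where
  \<open>s z\<close> is constant. It grows by \<open>\<pi> / 2\<close> from the identity to the exceptional set. This
  value is the supremum of the integrals: on the shifted hyperbolas \<open>(s + \<delta>) (z + k \<delta>) = const\<close>
  through \<open>(1, 0)\<close> and \<open>(0, k)\<close> they tend to \<open>\<pi> / 2\<close> as \<open>\<delta> \<rightarrow> 0\<close>
  (\<open>nearly_extremal_curve\<close>). A curve that attains it would have to keep
  \<open>s z\<close> at its boundary value \<open>0\<close>, but on the way from \<open>s > z\<close> to \<open>s < z\<close> with \<open>s + z > 0\<close> it meets a point
  with \<open>s = z > 0\<close>.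

  To turn the last remark into a strict inequality (\<open>null_length_less\<close>), cut the curve at this
  point. The translation \<open>s \<mapsto> s - h\<close>, \<open>z \<mapsto> z + h\<close> is an isometry, so
  \<open>arctan (sqrt ((z + h) / (s - h)))\<close> is a calibration as well. On the first half a small \<open>h > 0\<close>
  keeps it regular at the starting point and lowers its total growth below \<open>\<pi> / 4\<close>: the value at the
  start rises by about \<open>sqrt h\<close>, the one at the cut only by a multiple of \<open>h\<close>. On the second
  half \<open>h < 0\<close> does the same (\<open>arctan_split_gain\<close>).\<close>

section \<open>Lipschitz functions with almost everywhere given derivative\<close>

lemma seq_difference_quotient:
  fixes f :: "real \<Rightarrow> real"
  assumes "(f has_real_derivative D) (at t within {a..b})" "a \<le> t" "t < b"
  shows "(\<lambda>n. (f (t + 1 / Suc n) - f t) / (1 / Suc n)) \<longlonglongrightarrow> D"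
proof -
  have lim: "(\<lambda>n. t + 1 / Suc n) \<longlonglongrightarrow> t"
    using tendsto_add[OF tendsto_const LIMSEQ_inverse_real_of_nat, of t] by (simp add: inverse_eq_divide)
  have "\<forall>\<^sub>F n in sequentially. t + 1 / Suc n < b"
    using order_tendstoD(2)[OF lim \<open>t < b\<close>] .
  then have "\<forall>\<^sub>F n in sequentially. t + 1 / Suc n \<in> {a..b} \<and> t + 1 / Suc n \<noteq> t"
    by eventually_elim (use assms in \<open>auto intro: add_increasing2\<close>)
  then have "filterlim (\<lambda>n. t + 1 / Suc n) (at t within {a..b}) sequentially"
    using lim by (auto simp: filterlim_at elim: eventually_mono)
  from filterlim_compose[OF assms(1)[unfolded has_field_derivative_iff] this]
  show ?thesis by simp
qed

text \<open>A Lipschitz function is the integral of its almost everywhere defined derivative. The difference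
  quotients are bounded by the Lipschitz constant and converge almost everywhere, so dominated
  convergence applies; their integrals are difference quotients of a primitive of the function and
  converge to its boundary values.\<close>

theorem lipschitz_fundamental_theorem_of_calculus:
  fixes f :: "real \<Rightarrow> real"
  assumes "a \<le> b" and lip: "L-lipschitz_on {a..b} f" and N: "negligible N"
    and der: "\<And>t. t \<in> {a..b} - N \<Longrightarrow> (f has_real_derivative f' t) (at t within {a..b})"
  shows "(f' has_integral f b - f a) {a..b}"
proof -
  \<comment> \<open>The constant extension lets the difference quotients at \<open>t\<close> near \<open>b\<close> look beyond \<open>b\<close>.\<close>
  define F where "F t = f (max a (min b t))" for t
  have F_lip: "\<bar>F t - F u\<bar> \<le> L * \<bar>t - u\<bar>" for t u
  proof -
    have "\<bar>F t - F u\<bar> \<le> L * \<bar>max a (min b t) - max a (min b u)\<bar>"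
      using lipschitz_onD[OF lip, of "max a (min b t)" "max a (min b u)"] \<open>a \<le> b\<close>
      by (auto simp: F_def dist_real_def)
    also have "\<dots> \<le> L * \<bar>t - u\<bar>"
      by (rule mult_left_mono) (use lipschitz_on_nonneg[OF lip] in auto)
    finally show ?thesis .
  qed
  have "L-lipschitz_on UNIV F"
    using F_lip lipschitz_on_nonneg[OF lip] by (auto intro!: lipschitz_onI simp: dist_real_def)
  then have F_cont: "continuous_on S F" for S
    using continuous_on_subset lipschitz_on_continuous_on by blast
  \<comment> \<open>The primitive starts left of \<open>a\<close>, so that it has two-sided derivatives on \<open>{a..b}\<close>.\<close>
  define I where "I u = integral {a - 1..u} F" for u
  have I_der: "(I has_real_derivative F t) (at t)" if "t \<in> {a - 1<..<b + 2}" for t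
    using integral_has_real_derivative[OF F_cont, of t "a - 1" "b + 2"] that
    by (auto simp: I_def[abs_def] at_within_Icc_at)
  define D where "D n t = (F (t + 1 / Suc n) - F t) / (1 / Suc n)" for n t
  define J where "J n t = (I (t + 1 / Suc n) - I t) / (1 / Suc n)" for n t
  have D_int: "(D n has_integral J n b - J n a) {a..b}" for n
  proof (rule fundamental_theorem_of_calculus[OF \<open>a \<le> b\<close>])
    fix t assume t: "t \<in> {a..b}"
    have e: "1 / real (Suc n) \<in> {0<..1}" by simp
    have "((\<lambda>u. I (u + 1 / Suc n)) has_real_derivative F (t + 1 / Suc n)) (at t)"
      using I_der[of "t + 1 / Suc n"] t e unfolding DERIV_shift
      by (smt (verit) atLeastAtMost_iff greaterThanAtMost_iff greaterThanLessThan_iff)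
    moreover have "(I has_real_derivative F t) (at t)"
      using t by (intro I_der) auto
    ultimately have "(J n has_real_derivative D n t) (at t)"
      unfolding J_def[abs_def] D_def
      by (intro DERIV_cdivide DERIV_diff)
    then show "(J n has_vector_derivative D n t) (at t within {a..b})"
      by (simp add: has_real_derivative_iff_has_vector_derivative has_vector_derivative_at_within)
  qed
  have J_lim: "(\<lambda>n. J n t) \<longlonglongrightarrow> F t" if "t \<in> {a..b}" for t
    unfolding J_def
    by (rule seq_difference_quotient[of _ _ _ "a - 1" "b + 1"])
       (use that in \<open>auto intro!: has_field_derivative_at_within I_der\<close>)
  have D_lim: "(\<lambda>n. D n t) \<longlonglongrightarrow> f' t" if "t \<in> {a..b} - (N \<union> {b})" for t
    unfolding D_def
  proof (rule seq_difference_quotient)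
    have "(F has_real_derivative f' t) (at t within {a..b}) \<longleftrightarrow>
          (f has_real_derivative f' t) (at t within {a..b})"
      using that by (intro has_field_derivative_cong_eventually) (auto simp: F_def eventually_at_filter)
    then show "(F has_real_derivative f' t) (at t within {a..b})"
      using der that by auto
  qed (use that in auto)
  \<comment> \<open>The quotients at \<open>b\<close> see only the constant extension, hence \<open>b\<close> is discarded along with \<open>N\<close>.\<close>
  let ?c = "\<lambda>g t. if t \<in> N \<union> {b} then 0 else g t :: real"
  have N': "negligible (N \<union> {b})" using N by simp
  have "(?c f' has_integral F b - F a) {a..b}"
  proof (rule has_integral_dominated_convergence[where f = "\<lambda>n. ?c (D n)" and h = "\<lambda>_. L"])
    show "(?c (D n) has_integral J n b - J n a) {a..b}" for n
      by (rule has_integral_spike[OF N' _ D_int]) auto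
    show "\<forall>t\<in>{a..b}. norm (?c (D n) t) \<le> L" for n
    proof -
      have "\<bar>D n t\<bar> \<le> L" for t
        using F_lip[of "t + 1 / Suc n" t] by (simp add: D_def divide_simps abs_mult mult.commute)
      then show ?thesis using lipschitz_on_nonneg[OF lip] by auto
    qed
    show "\<forall>t\<in>{a..b}. (\<lambda>n. ?c (D n) t) \<longlonglongrightarrow> ?c f' t"
      using D_lim by auto
    show "(\<lambda>n. J n b - J n a) \<longlonglongrightarrow> F b - F a"
      using \<open>a \<le> b\<close> by (intro tendsto_diff J_lim) auto
  qed (rule integrable_const_ivl)
  then have "(f' has_integral F b - F a) {a..b}"
    by (rule has_integral_spike[OF N', rotated]) auto
  then show ?thesis using \<open>a \<le> b\<close> by (simp add: F_def)
qed

lemma lipschitz_nonneg_derivative_mono: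
  fixes f :: "real \<Rightarrow> real"
  assumes lip: "L-lipschitz_on {a..b} f" and N: "negligible N"
    and der: "\<And>t. t \<in> {a..b} - N \<Longrightarrow> (f has_real_derivative f' t) (at t within {a..b})"
    and nonneg: "\<And>t. t \<in> {a..b} - N \<Longrightarrow> 0 \<le> f' t"
    and tu: "a \<le> t" "t \<le> u" "u \<le> b"
  shows "f t \<le> f u"
proof -
  have sub: "{t..u} \<subseteq> {a..b}" using tu by auto
  have "(f' has_integral f u - f t) {t..u}"
    by (rule lipschitz_fundamental_theorem_of_calculus[OF tu(2) lipschitz_on_subset[OF lip sub] N])
       (use sub der in \<open>blast intro: has_field_derivative_subset\<close>)
  then have "((\<lambda>r. if r \<in> N then 0 else f' r) has_integral f u - f t) {t..u}"
    by (rule has_integral_spike[OF N, rotated]) auto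
  then have "0 \<le> f u - f t"
    by (rule has_integral_nonneg) (use nonneg sub in auto)
  then show ?thesis by simp
qed

lemma lipschitz_on_real_derivative:
  fixes f :: "real \<Rightarrow> real"
  assumes "convex X" "C \<ge> 0"
    and "\<And>x. x \<in> X \<Longrightarrow> (f has_real_derivative f' x) (at x within X)"
    and "\<And>x. x \<in> X \<Longrightarrow> \<bar>f' x\<bar> \<le> C"
  shows "C-lipschitz_on X f"
proof (rule bounded_derivative_imp_lipschitz)
  show "(f has_derivative (\<lambda>h. f' x * h)) (at x within X)" if "x \<in> X" for x
    using assms(3)[OF that] by (simp add: has_field_derivative_def)
  show "onorm (\<lambda>h. f' x * h) \<le> C" if "x \<in> X" for x
    using assms(4)[OF that] \<open>C \<ge> 0\<close> by (intro onorm_bound) (simp_all add: abs_mult mult_right_mono)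
qed (use assms in auto)

lemma AE_lebesgue_on_negligible:
  fixes S :: "real set"
  assumes "AE t in lebesgue_on S. P t" "S \<in> sets lebesgue"
  obtains N where "negligible N" "\<And>t. t \<in> S - N \<Longrightarrow> P t"
proof -
  have "AE t in lebesgue. t \<in> S \<longrightarrow> P t"
    using assms by (simp add: AE_restrict_space_iff)
  then obtain N where "N \<in> null_sets lebesgue" "{t. \<not> (t \<in> S \<longrightarrow> P t)} \<subseteq> N"
    by (auto simp: eventually_ae_filter)
  then show ?thesis
    by (intro that[of N]) (auto simp: negligible_iff_null_sets)
qed

section \<open>Calibration of the length in null coordinates\<close>

text \<open>The logarithmic form of \<open>arctan (sqrt (z / s))\<close>: along a Lipschitz curve that stays away from the
  axes it is a composition of Lipschitz functions of one variable.\<close>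

definition null_angle :: "real \<Rightarrow> real \<Rightarrow> real" where
  "null_angle s z = arctan (exp ((ln z - ln s) / 2))"

lemma exp_half_ln_diff:
  fixes s z :: real
  assumes "s > 0" "z > 0"
  shows "exp ((ln z - ln s) / 2) = sqrt (z / s)"
proof -
  have "(ln z - ln s) / 2 = ln (sqrt (z / s))"
    using assms by (simp add: ln_sqrt ln_div)
  then show ?thesis using assms by simp
qed

lemma null_angle_eq: "s > 0 \<Longrightarrow> z > 0 \<Longrightarrow> null_angle s z = arctan (sqrt (z / s))"
  by (simp add: null_angle_def exp_half_ln_diff)

lemma lipschitz_arctan_exp: "(1/4)-lipschitz_on UNIV (\<lambda>x. arctan (exp (x / 2)))"
proof (rule lipschitz_on_real_derivative)
  fix x :: real
  let ?d = "inverse (1 + (exp (x / 2))\<^sup>2) * (exp (x / 2) / 2)"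
  show "((\<lambda>x. arctan (exp (x / 2))) has_real_derivative ?d) (at x within UNIV)"
    by (auto intro!: derivative_eq_intros)
  have "2 * exp (x / 2) \<le> 1 + (exp (x / 2))\<^sup>2"
    using sum_squares_bound[of 1 "exp (x/2)"] by simp
  moreover have "1 + (exp (x / 2))\<^sup>2 > 0"
    by (simp add: add_pos_nonneg)
  ultimately show "\<bar>?d\<bar> \<le> 1 / 4"
    by (simp add: divide_simps abs_mult)
qed auto

lemma lipschitz_ln:
  assumes "e > 0" shows "(1/e)-lipschitz_on {e..} ln"
proof (rule lipschitz_on_real_derivative)
  show "(ln has_real_derivative 1 / x) (at x within {e..})" if "x \<in> {e..}" for x
    using assms that by (auto intro!: derivative_eq_intros)
qed (use assms in \<open>auto simp: frac_le\<close>)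

lemma lipschitz_ln_compose:
  fixes f :: "real \<Rightarrow> real"
  assumes "a \<le> b" "L-lipschitz_on {a..b} f" "\<And>t. t \<in> {a..b} \<Longrightarrow> f t > 0"
  shows "\<exists>M. M-lipschitz_on {a..b} (\<lambda>t. ln (f t))"
proof -
  have "continuous_on {a..b} f" using assms(2) lipschitz_on_continuous_on by blast
  then obtain u where u: "u \<in> {a..b}" "\<And>t. t \<in> {a..b} \<Longrightarrow> f u \<le> f t"
    using continuous_attains_inf[of "{a..b}" f] \<open>a \<le> b\<close> by auto
  have "(1 / f u * L)-lipschitz_on {a..b} (\<lambda>t. ln (f t))"
    by (rule lipschitz_on_compose2[OF assms(2) lipschitz_on_subset[OF lipschitz_ln]]) (use u assms(3) in auto)
  then show ?thesis ..
qed

text \<open>The calibration inequality: the left-hand side is the speed \<open>sqrt (- S' Z') / (S + Z)\<close> with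
  \<open>p = - S'\<close>, \<open>r = Z'\<close>, and the right-hand side is the derivative of \<open>null_angle S Z\<close>.\<close>

lemma null_speed_le:
  fixes S Z p r :: real
  assumes "S > 0" "Z > 0" "p \<ge> 0" "r \<ge> 0"
  defines "e \<equiv> exp ((ln Z - ln S) / 2)"
  shows "sqrt (p * r) / (S + Z) \<le> inverse (1 + e\<^sup>2) * (e * ((r / Z + p / S) / 2))"
proof -
  have e: "e = sqrt Z / sqrt S"
    using assms by (simp add: exp_half_ln_diff real_sqrt_divide)
  have e2: "inverse (1 + e\<^sup>2) * e = sqrt Z * sqrt S / (S + Z)"
  proof -
    have "1 + e\<^sup>2 = (S + Z) / S" using assms(1-4) by (simp add: e power_divide field_simps)
    then show ?thesis using assms(1-4) by (simp add: e divide_simps)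
  qed
  have "sqrt (p * r) = sqrt Z * sqrt S * sqrt (r / Z * (p / S))"
    using assms by (simp add: real_sqrt_mult real_sqrt_divide)
  also have "\<dots> \<le> sqrt Z * sqrt S * ((r / Z + p / S) / 2)"
    using assms by (intro mult_left_mono arith_geo_mean_sqrt) auto
  finally have "sqrt (p * r) / (S + Z) \<le> sqrt Z * sqrt S * ((r / Z + p / S) / 2) / (S + Z)"
    using assms(1,2) by (intro divide_right_mono) auto
  also have "\<dots> = inverse (1 + e\<^sup>2) * e * ((r / Z + p / S) / 2)"
    unfolding e2 by simp
  finally show ?thesis by (simp only: mult.assoc)
qed

text \<open>The shift by \<open>h\<close> leaves the speed unchanged, since only \<open>s + z\<close> and the derivatives enter it. It is the
  freedom to choose \<open>h\<close> that later makes the estimate strict.\<close>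

lemma null_length_le:
  fixes s z :: "real \<Rightarrow> real"
  assumes "a \<le> b" "L-lipschitz_on {a..b} s" "M-lipschitz_on {a..b} z" and N: "negligible N"
    and s': "\<And>t. t \<in> {a..b} - N \<Longrightarrow> (s has_real_derivative s' t) (at t within {a..b})"
    and z': "\<And>t. t \<in> {a..b} - N \<Longrightarrow> (z has_real_derivative z' t) (at t within {a..b})"
    and mono: "\<And>t. t \<in> {a..b} - N \<Longrightarrow> s' t \<le> 0 \<and> 0 \<le> z' t"
    and pos: "\<And>t. t \<in> {a..b} \<Longrightarrow> h < s t \<and> - h < z t"
    and g: "\<And>t. t \<in> {a..b} - N \<Longrightarrow> g t = sqrt (- s' t * z' t) / (s t + z t)"
    and int: "g integrable_on {a..b}"
  shows "integral {a..b} g \<le> null_angle (s b - h) (z b + h) - null_angle (s a - h) (z a + h)"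
proof -
  let ?\<phi> = "\<lambda>t. null_angle (s t - h) (z t + h)"
  define e where "e t = exp ((ln (z t + h) - ln (s t - h)) / 2)" for t
  define d where "d t = inverse (1 + (e t)\<^sup>2) * (e t * ((z' t / (z t + h) + - s' t / (s t - h)) / 2))" for t
  have "(L + 0)-lipschitz_on {a..b} (\<lambda>t. s t - h)" "(M + 0)-lipschitz_on {a..b} (\<lambda>t. z t + h)"
    by (intro lipschitz_intros assms)+
  then have "\<exists>K. K-lipschitz_on {a..b} (\<lambda>t. ln (s t - h))"
    "\<exists>K. K-lipschitz_on {a..b} (\<lambda>t. ln (z t + h))"
    by (auto intro!: lipschitz_ln_compose[OF \<open>a \<le> b\<close>] dest!: pos)
  then obtain K1 K2 where "K1-lipschitz_on {a..b} (\<lambda>t. ln (s t - h))" "K2-lipschitz_on {a..b} (\<lambda>t. ln (z t + h))"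
    by blast
  then have "(K2 + K1)-lipschitz_on {a..b} (\<lambda>t. ln (z t + h) - ln (s t - h))"
    by (intro lipschitz_intros)
  then have lip: "(1/4 * (K2 + K1))-lipschitz_on {a..b} ?\<phi>"
    unfolding null_angle_def
    by (rule lipschitz_on_compose2[OF _ lipschitz_on_subset[OF lipschitz_arctan_exp]]) auto
  have "(d has_integral ?\<phi> b - ?\<phi> a) {a..b}"
  proof (rule lipschitz_fundamental_theorem_of_calculus[OF \<open>a \<le> b\<close> lip N])
    fix t assume t: "t \<in> {a..b} - N"
    with pos[of t] have p: "z t + h > 0" "s t - h > 0" by auto
    show "(?\<phi> has_real_derivative d t) (at t within {a..b})"
      unfolding null_angle_def d_def e_def
      using p by (auto intro!: derivative_eq_intros s'[OF t] z'[OF t])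
  qed
  moreover have "(g has_integral integral {a..b} g) {a..b}"
    using int by (rule integrable_integral)
  then have "((\<lambda>t. if t \<in> N then d t else g t) has_integral integral {a..b} g) {a..b}"
    by (rule has_integral_spike[OF N, rotated]) auto
  moreover have "(if t \<in> N then d t else g t) \<le> d t" if "t \<in> {a..b}" for t
    using null_speed_le[of "s t - h" "z t + h" "- s' t" "z' t"] mono[of t] pos[of t] that
    by (auto simp: g d_def e_def)
  ultimately show ?thesis
    using has_integral_le by blast
qed

section \<open>Length strictly below the supremum\<close>

text \<open>Compare \<open>null_angle (s - h) (z + h)\<close> at the points \<open>(m, m)\<close> and \<open>(k, 0)\<close>: for a suitable \<open>h > 0\<close>
  it grows by less than \<open>\<pi> / 4\<close>, its growth for \<open>h = 0\<close>. The value at \<open>(k, 0)\<close> is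
  \<open>arctan x\<close> if \<open>h / (k - h) = x\<^sup>2\<close>. For \<open>x = m / (2 k)\<close> the value at \<open>(m, m)\<close> is small enough, since then
  \<open>h / m = x / (2 (1 + x\<^sup>2)) < x\<close> while
  \<open>\<pi> / 4 + arctan x = arctan ((1 + x) / (1 - x))\<close>.\<close>

lemma arctan_split_gain:
  fixes m k :: real
  assumes "0 < m" "m \<le> k"
  obtains h where "0 < h" "h < m"
    "arctan (sqrt ((m + h) / (m - h))) < pi / 4 + arctan (sqrt (h / (k - h)))"
proof -
  define x where "x = m / (2 * k)"
  define y where "y = x / (2 * (1 + x\<^sup>2))"
  define h where "h = m * y"
  have x: "0 < x" "x \<le> 1 / 2" using assms by (auto simp: x_def divide_simps)
  have x2: "1 + x\<^sup>2 > 0" by (simp add: add_pos_nonneg)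
  have y: "0 < y" "y < x" using x x2 by (auto simp: y_def divide_simps intro: add_pos_nonneg)
  have h: "0 < h" "h < m" using assms x y by (auto simp: h_def)
  have hk: "h = k * x\<^sup>2 / (1 + x\<^sup>2)"
    using assms x2 by (simp add: h_def y_def) (simp add: x_def field_simps power2_eq_square)
  have "h / (k - h) = x\<^sup>2"
  proof -
    have "k - h = k / (1 + x\<^sup>2)" using x2 by (simp add: hk field_simps)
    then show ?thesis using assms x2 by (simp add: hk)
  qed
  then have sx: "sqrt (h / (k - h)) = x" using x by simp
  have "(m + h) / (m - h) = (1 + y) / (1 - y)"
  proof -
    have "m + h = m * (1 + y)" "m - h = m * (1 - y)" by (simp_all add: h_def algebra_simps)
    then show ?thesis using assms by simp
  qed
  also have "\<dots> < (1 + x) / (1 - x)"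
    using x y by (simp add: divide_simps algebra_simps)
  also have "\<dots> \<le> ((1 + x) / (1 - x))\<^sup>2"
    using x by (intro self_le_power) auto
  finally have "sqrt ((m + h) / (m - h)) < (1 + x) / (1 - x)"
    using x by (intro real_less_lsqrt) auto
  then have "arctan (sqrt ((m + h) / (m - h))) < arctan ((1 + x) / (1 - x))"
    by (simp add: arctan_less_iff)
  also have "\<dots> = arctan 1 + arctan x"
    using arctan_add[of 1 x] x by simp
  finally show ?thesis
    using h sx by (intro that) (auto simp: arctan_one)
qed

text \<open>A curve from \<open>(s, 0)\<close> to \<open>(0, z)\<close> in the half-plane \<open>s + z > 0\<close> crosses the diagonal
  \<open>s = z\<close> at a point \<open>(m, m)\<close> with \<open>m > 0\<close>, and the shifted calibration bounds the
  length of each of the two parts by less than \<open>\<pi> / 4\<close>.\<close>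

lemma null_length_less:
  fixes s z :: "real \<Rightarrow> real"
  assumes "0 < T" "L-lipschitz_on {0..T} s" "M-lipschitz_on {0..T} z" and N: "negligible N"
    and s': "\<And>t. t \<in> {0..T} - N \<Longrightarrow> (s has_real_derivative s' t) (at t within {0..T})"
    and z': "\<And>t. t \<in> {0..T} - N \<Longrightarrow> (z has_real_derivative z' t) (at t within {0..T})"
    and mono: "\<And>t. t \<in> {0..T} - N \<Longrightarrow> s' t \<le> 0 \<and> 0 \<le> z' t"
    and pos: "\<And>t. t \<in> {0..T} \<Longrightarrow> 0 < s t + z t"
    and ends: "z 0 = 0" "s T = 0"
    and g: "\<And>t. t \<in> {0..T} - N \<Longrightarrow> g t = sqrt (- s' t * z' t) / (s t + z t)"
    and int: "g integrable_on {0..T}"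
  shows "integral {0..T} g < pi / 2"
proof -
  have z_mono: "z t \<le> z u" if "0 \<le> t" "t \<le> u" "u \<le> T" for t u
    by (rule lipschitz_nonneg_derivative_mono[OF assms(3) N z']) (use mono that in auto)
  have "L-lipschitz_on {0..T} (\<lambda>t. - s t)"
    using assms(2) by (simp add: lipschitz_on_minus_iff)
  then have s_mono: "s u \<le> s t" if "0 \<le> t" "t \<le> u" "u \<le> T" for t u
    using lipschitz_nonneg_derivative_mono[of L 0 T "\<lambda>t. - s t" N "\<lambda>t. - s' t" t u]
      N DERIV_minus[OF s'] mono that by auto
  have cont: "continuous_on {0..T} (\<lambda>t. z t - s t)"
    using assms(2,3) by (intro continuous_on_diff lipschitz_on_continuous_on)
  obtain c where c: "0 \<le> c" "c \<le> T" "z c - s c = 0"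
    using IVT'[of "\<lambda>t. z t - s t" 0 0 T] cont \<open>0 < T\<close> pos[of 0] pos[of T] ends by auto
  define m where "m = z c"
  have m: "0 < m" "z c = m" "s c = m" using c pos[of c] by (auto simp: m_def)
  have ms: "m \<le> s 0" and mz: "m \<le> z T" using c m s_mono[of 0 c] z_mono[of c T] by auto
  obtain h where h: "0 < h" "h < m"
    "arctan (sqrt ((m + h) / (m - h))) < pi / 4 + arctan (sqrt (h / (s 0 - h)))"
    using arctan_split_gain[OF m(1) ms] .
  obtain k where k: "0 < k" "k < m"
    "arctan (sqrt ((m + k) / (m - k))) < pi / 4 + arctan (sqrt (k / (z T - k)))"
    using arctan_split_gain[OF m(1) mz] .
  have flip: "arctan (sqrt (x / y)) = pi / 2 - arctan (sqrt (y / x))" if "0 < x" "0 < y" for x y :: real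
    using arctan_inverse[of "sqrt (y / x)"] that by (simp add: real_sqrt_divide sgn_if)
  have sub1: "{0..c} \<subseteq> {0..T}" and sub2: "{c..T} \<subseteq> {0..T}" using c by auto
  have "integral {0..c} g \<le> null_angle (s c - h) (z c + h) - null_angle (s 0 - h) (z 0 + h)"
  proof (rule null_length_le[OF c(1) lipschitz_on_subset[OF assms(2) sub1]
      lipschitz_on_subset[OF assms(3) sub1] N, of s' z'])
    show "h < s t \<and> - h < z t" if "t \<in> {0..c}" for t
      using s_mono[of t c] z_mono[of 0 t] that c m h ends by auto
    show "g integrable_on {0..c}" using int sub1 by (rule integrable_subinterval_real)
  qed (use sub1 mono g in \<open>auto intro!: has_field_derivative_subset[OF s' sub1] has_field_derivative_subset[OF z' sub1]\<close>)
  also have "\<dots> < pi / 4"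
    using h m ms ends by (simp add: null_angle_eq)
  finally have 1: "integral {0..c} g < pi / 4" .
  \<comment> \<open>Time reversal exchanges the roles of \<open>s\<close> and \<open>z\<close>, so on the second part the shift is negative.\<close>
  have "integral {c..T} g \<le> null_angle (s T - - k) (z T + - k) - null_angle (s c - - k) (z c + - k)"
  proof (rule null_length_le[OF c(2) lipschitz_on_subset[OF assms(2) sub2]
      lipschitz_on_subset[OF assms(3) sub2] N, of s' z'])
    show "- k < s t \<and> - (- k) < z t" if "t \<in> {c..T}" for t
      using s_mono[of t T] z_mono[of c t] that c m k ends by auto
    show "g integrable_on {c..T}" using int sub2 by (rule integrable_subinterval_real)
  qed (use sub2 mono g in \<open>auto intro!: has_field_derivative_subset[OF s' sub2] has_field_derivative_subset[OF z' sub2]\<close>)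
  also have "\<dots> < pi / 4"
    using k m mz ends flip[of "z T - k" k] flip[of "m - k" "m + k"] by (simp add: null_angle_eq)
  finally have "integral {c..T} g < pi / 4" .
  moreover have "integral {0..T} g = integral {0..c} g + integral {c..T} g"
    using Henstock_Kurzweil_Integration.integral_combine[OF c(1,2) int] by simp
  ultimately show ?thesis using 1 by simp
qed

section \<open>Null coordinates on the affine group\<close>

text \<open>Since \<open>K = (c\<^sup>2 - a\<^sup>2) / |A|\<^sup>2\<close>, the two inequalities on the first column express \<open>K < 0\<close> and \<open>a \<ge> 0\<close>.\<close>

locale negative_curvature =
  fixes A :: "real^2^2"
  assumes det_pos: "det A > 0" and plus_pos: "A$1$1 + A$2$1 > 0" and minus_pos: "A$1$1 - A$2$1 > 0"
begin

text \<open>The null components of a vector are \<open>v\<^sub>1 - v\<^sub>2 = a_minus u\<^sub>1 + b_minus u\<^sub>2\<close> and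
  \<open>v\<^sub>1 + v\<^sub>2 = a_plus u\<^sub>1 + b_plus u\<^sub>2\<close>.\<close>

definition "a_minus = A$1$1 - A$2$1"
definition "a_plus = A$1$1 + A$2$1"
definition "b_minus = A$1$2 - A$2$2"
definition "b_plus = A$1$2 + A$2$2"
definition "\<Delta> = 2 * det A"

lemma a_pos: "a_minus > 0" "a_plus > 0"
  using plus_pos minus_pos by (simp_all add: a_minus_def a_plus_def)

lemma Delta_pos: "\<Delta> > 0"
  using det_pos by (simp add: \<Delta>_def)

lemma Delta_eq: "\<Delta> = a_minus * b_plus - a_plus * b_minus"
  by (simp add: \<Delta>_def det_2 a_minus_def a_plus_def b_minus_def b_plus_def algebra_simps)

text \<open>Multiplied by \<open>y\<close>, the two null components of a velocity become the derivatives of affine functions of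
  \<open>(x, y)\<close>. The factors and the additive constant are chosen so that these functions add up to \<open>y\<close>.\<close>

definition null_s :: "real \<times> real \<Rightarrow> real" where
  "null_s p = 1 - a_plus / \<Delta> * (a_minus * fst p + b_minus * (snd p - 1))"

definition null_z :: "real \<times> real \<Rightarrow> real" where
  "null_z p = a_minus / \<Delta> * (a_plus * fst p + b_plus * (snd p - 1))"

text \<open>The inverse of the coordinate map \<open>p \<mapsto> (null_s p, null_z p)\<close>.\<close>

definition of_null :: "real \<Rightarrow> real \<Rightarrow> real \<times> real" where
  "of_null s z = (b_plus / a_plus * (1 - s) - b_minus / a_minus * z, s + z)"

text \<open>The constant ratio of the Lorentzian speed to \<open>sqrt (- s' z') / (s + z)\<close>.\<close>

definition length_scale :: real where
  "length_scale = \<Delta> / sqrt (a_minus * a_plus)"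

lemma length_scale_pos: "length_scale > 0"
  using Delta_pos a_pos by (simp add: length_scale_def)

lemma null_s_plus_null_z: "null_s p + null_z p = snd p"
proof -
  have "null_s p + null_z p = 1 + (a_minus * b_plus - a_plus * b_minus) * (snd p - 1) / \<Delta>"
    using Delta_pos by (simp add: null_s_def null_z_def divide_simps) (simp add: algebra_simps)
  then show ?thesis using Delta_pos by (simp add: Delta_eq[symmetric])
qed

lemma of_null_null: "of_null (null_s p) (null_z p) = p"
proof (rule prod_eqI)
  show "snd (of_null (null_s p) (null_z p)) = snd p"
    by (simp add: of_null_def null_s_plus_null_z)
  have "fst (of_null (null_s p) (null_z p)) =
      (b_plus * (a_minus * fst p + b_minus * (snd p - 1))
       - b_minus * (a_plus * fst p + b_plus * (snd p - 1))) / \<Delta>"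
    using a_pos Delta_pos by (simp add: of_null_def null_s_def null_z_def diff_divide_distrib)
  also have "\<dots> = (a_minus * b_plus - a_plus * b_minus) * fst p / \<Delta>"
    by (simp add: algebra_simps)
  finally show "fst (of_null (null_s p) (null_z p)) = fst p"
    using Delta_pos by (simp add: Delta_eq[symmetric])
qed

lemma null_coordinates_one: "null_s (0, 1) = 1" "null_z (0, 1) = 0"
  by (simp_all add: null_s_def null_z_def)

text \<open>\<open>\<lambda>\<^sub>1\<close> is an affine function of \<open>s\<close> alone, and the point \<open>B\<close>, at which \<open>y = 0\<close>, is the
  origin of the null coordinates.\<close>

lemma null_s_F_set:
  assumes "p \<in> F_set A" shows "null_s p = 0"
proof -
  have "lambda1 A r = - (a_minus * fst r + b_minus * (snd r - 1))" for r
    by (simp add: lambda1_def a_minus_def b_minus_def algebra_simps)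
  moreover have "B_point A = (b_plus / a_plus, 0)"
    by (simp add: B_point_def a_plus_def b_plus_def add.commute)
  ultimately have "a_minus * fst p + b_minus * (snd p - 1) = a_minus * (b_plus / a_plus) - b_minus"
    using assms by (simp add: F_set_def lambda3_def)
  also have "\<dots> = \<Delta> / a_plus"
    using a_pos by (simp add: Delta_eq diff_divide_distrib)
  finally show ?thesis
    using a_pos Delta_pos by (simp add: null_s_def)
qed

text \<open>The linear parts of \<open>null_s\<close> and \<open>null_z\<close>.\<close>

definition ds :: "real \<times> real \<Rightarrow> real" where
  "ds w = - (a_plus / \<Delta> * (a_minus * fst w + b_minus * snd w))"

definition dz :: "real \<times> real \<Rightarrow> real" where
  "dz w = a_minus / \<Delta> * (a_plus * fst w + b_plus * snd w)"

lemma null_derivative: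
  assumes "(q has_vector_derivative w) (at t within S)"
  shows "((\<lambda>t. null_s (q t)) has_real_derivative ds w) (at t within S)"
    "((\<lambda>t. null_z (q t)) has_real_derivative dz w) (at t within S)"
proof -
  have f: "((\<lambda>t. fst (q t)) has_real_derivative fst w) (at t within S)"
    "((\<lambda>t. snd (q t)) has_real_derivative snd w) (at t within S)"
    using bounded_linear.has_vector_derivative[OF bounded_linear_fst assms]
      bounded_linear.has_vector_derivative[OF bounded_linear_snd assms]
    by (simp_all add: has_real_derivative_iff_has_vector_derivative)
  have "((\<lambda>t. null_s (q t)) has_real_derivative
      0 - a_plus / \<Delta> * (a_minus * fst w + b_minus * (snd w - 0))) (at t within S)"
    unfolding null_s_def by (intro DERIV_diff DERIV_add DERIV_cmult DERIV_const f)
  then show "((\<lambda>t. null_s (q t)) has_real_derivative ds w) (at t within S)" by (simp add: ds_def)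
  have "((\<lambda>t. null_z (q t)) has_real_derivative
      a_minus / \<Delta> * (a_plus * fst w + b_plus * (snd w - 0))) (at t within S)"
    unfolding null_z_def by (intro DERIV_diff DERIV_add DERIV_cmult DERIV_const f)
  then show "((\<lambda>t. null_z (q t)) has_real_derivative dz w) (at t within S)" by (simp add: dz_def)
qed

lemma lipschitz_null:
  assumes "L-lipschitz_on X q"
  shows "\<exists>K. K-lipschitz_on X (\<lambda>t. null_s (q t))" "\<exists>K. K-lipschitz_on X (\<lambda>t. null_z (q t))"
proof -
  have f: "L-lipschitz_on X (\<lambda>t. fst (q t))" "L-lipschitz_on X (\<lambda>t. snd (q t))"
    using assms unfolding lipschitz_on_def by (meson dist_fst_le dist_snd_le order_trans)+
  note rules = lipschitz_on_diff lipschitz_on_add lipschitz_on_cmult_real lipschitz_on_constant f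
  show "\<exists>K. K-lipschitz_on X (\<lambda>t. null_s (q t))"
    unfolding null_s_def by (rule exI, (rule rules)+)
  show "\<exists>K. K-lipschitz_on X (\<lambda>t. null_z (q t))"
    unfolding null_z_def by (rule exI, (rule rules)+)
qed

lemma null_components:
  fixes p w :: "real \<times> real"
  assumes "snd p > 0"
  defines "v \<equiv> A *v frame_coords p w"
  shows "v $ 1 - v $ 2 = \<Delta> / a_plus * (- ds w / snd p)"
    "v $ 1 + v $ 2 = \<Delta> / a_minus * (dz w / snd p)"
proof -
  have "v $ 1 - v $ 2 = (a_minus * fst w + b_minus * snd w) / snd p"
    "v $ 1 + v $ 2 = (a_plus * fst w + b_plus * snd w) / snd p"
    by (simp_all add: v_def frame_coords_def matrix_vector_mult_def sum_2 a_minus_def a_plus_def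
        b_minus_def b_plus_def add_divide_distrib diff_divide_distrib algebra_simps)
  then show "v $ 1 - v $ 2 = \<Delta> / a_plus * (- ds w / snd p)"
    "v $ 1 + v $ 2 = \<Delta> / a_minus * (dz w / snd p)"
    using a_pos Delta_pos by (simp_all add: ds_def dz_def)
qed

lemma future_nonspacelike_iff:
  fixes p w :: "real \<times> real"
  assumes "snd p > 0"
  shows "future_nonspacelike A (frame_coords p w) \<longleftrightarrow> ds w \<le> 0 \<and> 0 \<le> dz w"
proof -
  let ?v = "A *v frame_coords p w"
  have "future_nonspacelike A (frame_coords p w) \<longleftrightarrow> 0 \<le> ?v $ 1 - ?v $ 2 \<and> 0 \<le> ?v $ 1 + ?v $ 2"
    by (auto simp: future_nonspacelike_def)
  then show ?thesis
    unfolding null_components[OF assms] using assms a_pos Delta_pos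
    by (simp add: zero_le_mult_iff mult_le_0_iff zero_le_divide_iff divide_le_0_iff)
qed

lemma lorentz_speed:
  fixes p w :: "real \<times> real"
  assumes "snd p > 0"
  defines "v \<equiv> A *v frame_coords p w"
  shows "sqrt ((v $ 1)\<^sup>2 - (v $ 2)\<^sup>2) = length_scale * (sqrt (- ds w * dz w) / snd p)"
proof -
  have e: "(x / a * (u / y)) * (x / b * (r / y)) = x\<^sup>2 / (b * a) * (u * r / y\<^sup>2)" for x a b u r y :: real
    by (simp add: power2_eq_square ac_simps)
  have "(v $ 1)\<^sup>2 - (v $ 2)\<^sup>2 = (v $ 1 - v $ 2) * (v $ 1 + v $ 2)"
    by (simp add: algebra_simps power2_eq_square)
  also have "\<dots> = \<Delta>\<^sup>2 / (a_minus * a_plus) * (- ds w * dz w / (snd p)\<^sup>2)"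
    unfolding v_def null_components[OF assms(1)] by (rule e)
  finally have "(v $ 1)\<^sup>2 - (v $ 2)\<^sup>2 = \<Delta>\<^sup>2 / (a_minus * a_plus) * (- ds w * dz w / (snd p)\<^sup>2)" .
  moreover have "sqrt (\<Delta>\<^sup>2 / (a_minus * a_plus) * (x / (snd p)\<^sup>2)) = length_scale * (sqrt x / snd p)" for x
    using assms(1) Delta_pos by (simp add: length_scale_def real_sqrt_mult real_sqrt_divide)
  ultimately show ?thesis by (simp only:)
qed

lemma lorentz_length_less:
  assumes curve: "future_nonspacelike_curve A T q"
    and ends: "q 0 = \<one>\<^bsub>Aff_plus\<^esub>" "q T \<in> F_set A"
  shows "lorentz_length A T q < length_scale * (pi / 2)"
proof -
  define q' where "q' t = vector_derivative q (at t within {0..T})" for t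
  let ?g = "\<lambda>t. sqrt (((A *v curve_velocity T q t) $ 1)\<^sup>2 - ((A *v curve_velocity T q t) $ 2)\<^sup>2)"
  have T: "0 < T" and y: "\<And>t. t \<in> {0..T} \<Longrightarrow> snd (q t) > 0"
    using curve by (auto simp: future_nonspacelike_curve_def Aff_plus_def Pi_iff)
  obtain L where "L-lipschitz_on {0..T} q"
    using curve by (auto simp: future_nonspacelike_curve_def)
  then obtain K1 K2 where lip: "K1-lipschitz_on {0..T} (\<lambda>t. null_s (q t))"
    "K2-lipschitz_on {0..T} (\<lambda>t. null_z (q t))"
    using lipschitz_null by blast
  obtain N where N: "negligible N"
    "\<And>t. t \<in> {0..T} - N \<Longrightarrow> q differentiable (at t within {0..T}) \<and>
      future_nonspacelike A (curve_velocity T q t)"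
    using AE_lebesgue_on_negligible[of "\<lambda>t. q differentiable (at t within {0..T}) \<and>
      future_nonspacelike A (curve_velocity T q t)" "{0..T}"] curve
    unfolding future_nonspacelike_curve_def by auto
  show ?thesis
  proof (cases "integrable (lebesgue_on {0..T}) ?g")
    case False
    \<comment> \<open>The integral then has the default value \<open>0\<close>.\<close>
    then have "lorentz_length A T q = 0"
      by (simp add: lorentz_length_def not_integrable_integral_eq)
    then show ?thesis using length_scale_pos by simp
  next
    case True
    then have int: "?g integrable_on {0..T}" "lorentz_length A T q = integral {0..T} ?g"
      by (simp_all add: lorentz_length_def integrable_on_lebesgue_on lebesgue_integral_eq_integral)
    have "integral {0..T} (\<lambda>t. ?g t / length_scale) < pi / 2"
    proof (rule null_length_less[OF T lip N(1), of "\<lambda>t. ds (q' t)" "\<lambda>t. dz (q' t)"])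
      fix t assume t: "t \<in> {0..T} - N"
      have d: "(q has_vector_derivative q' t) (at t within {0..T})"
        using N(2)[OF t] by (simp add: q'_def vector_derivative_works)
      show "((\<lambda>t. null_s (q t)) has_real_derivative ds (q' t)) (at t within {0..T})"
        "((\<lambda>t. null_z (q t)) has_real_derivative dz (q' t)) (at t within {0..T})"
        by (rule null_derivative[OF d])+
      show "ds (q' t) \<le> 0 \<and> 0 \<le> dz (q' t)"
        using N(2)[OF t] t y[of t] by (auto simp: curve_velocity_def q'_def[symmetric] future_nonspacelike_iff)
      show "?g t / length_scale = sqrt (- ds (q' t) * dz (q' t)) / (null_s (q t) + null_z (q t))"
        using t y[of t] length_scale_pos
        by (simp add: curve_velocity_def q'_def[symmetric] lorentz_speed null_s_plus_null_z)
    next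
      show "0 < null_s (q t) + null_z (q t)" if "t \<in> {0..T}" for t
        using y that by (simp add: null_s_plus_null_z)
      show "null_z (q 0) = 0" using ends by (simp add: Aff_plus_def null_coordinates_one)
      show "null_s (q T) = 0" using ends by (simp add: null_s_F_set)
      show "(\<lambda>t. ?g t / length_scale) integrable_on {0..T}"
        using int(1) by (rule integrable_on_divide)
    qed
    then show ?thesis
      using int(2) length_scale_pos by (simp add: divide_simps mult.commute)
  qed
qed

section \<open>Approximating the supremum\<close>

lemma ds_dz_of_null:
  "ds (b_plus / a_plus * (- u) - b_minus / a_minus * v, u + v) = u"
  "dz (b_plus / a_plus * (- u) - b_minus / a_minus * v, u + v) = v"
proof -
  have "a_minus * (b_plus / a_plus * (- u) - b_minus / a_minus * v) + b_minus * (u + v)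
      = - (a_minus * b_plus - a_plus * b_minus) / a_plus * u"
    "a_plus * (b_plus / a_plus * (- u) - b_minus / a_minus * v) + b_plus * (u + v)
      = (a_minus * b_plus - a_plus * b_minus) / a_minus * v"
    using a_pos by (simp_all add: divide_simps) (simp_all add: algebra_simps)
  then show "ds (b_plus / a_plus * (- u) - b_minus / a_minus * v, u + v) = u"
    "dz (b_plus / a_plus * (- u) - b_minus / a_minus * v, u + v) = v"
    using a_pos Delta_pos by (simp_all add: ds_def dz_def Delta_eq[symmetric])
qed

lemma curve_of_null:
  fixes s z s' z' :: "real \<Rightarrow> real"
  assumes T: "0 < T" and lip: "L-lipschitz_on {0..T} s" "M-lipschitz_on {0..T} z"
    and s': "\<And>t. t \<in> {0..T} \<Longrightarrow> (s has_real_derivative s' t) (at t within {0..T})"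
    and z': "\<And>t. t \<in> {0..T} \<Longrightarrow> (z has_real_derivative z' t) (at t within {0..T})"
    and mono: "\<And>t. t \<in> {0..T} \<Longrightarrow> s' t \<le> 0 \<and> 0 \<le> z' t"
    and pos: "\<And>t. t \<in> {0..T} \<Longrightarrow> 0 < s t + z t"
  defines "q \<equiv> \<lambda>t. of_null (s t) (z t)"
  shows "future_nonspacelike_curve A T q"
    and "lorentz_length A T q =
      (LINT t|lebesgue_on {0..T}. length_scale * (sqrt (- s' t * z' t) / (s t + z t)))"
proof -
  define w where
    "w t = (b_plus / a_plus * (- s' t) - b_minus / a_minus * z' t, s' t + z' t)" for t
  have d: "(q has_vector_derivative w t) (at t within {0..T})" if "t \<in> {0..T}" for t
  proof -
    have "((\<lambda>t. b_plus / a_plus * (1 - s t) - b_minus / a_minus * z t) has_real_derivative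
        b_plus / a_plus * (0 - s' t) - b_minus / a_minus * z' t) (at t within {0..T})"
      by (intro DERIV_diff DERIV_cmult DERIV_const s' z' that)
    moreover have "((\<lambda>t. s t + z t) has_real_derivative s' t + z' t) (at t within {0..T})"
      by (intro DERIV_add s' z' that)
    ultimately show ?thesis
      unfolding q_def of_null_def w_def
      by (intro has_vector_derivative_Pair) (simp_all add: has_real_derivative_iff_has_vector_derivative)
  qed
  have v: "curve_velocity T q t = frame_coords (q t) (w t)" if "t \<in> {0..T}" for t
    using vector_derivative_within_closed_interval[OF T _ d] that
    by (simp add: curve_velocity_def)
  have w: "ds (w t) = s' t" "dz (w t) = z' t" for t
    unfolding w_def by (rule ds_dz_of_null)+
  have y: "snd (q t) = s t + z t" for t
    by (simp add: q_def of_null_def)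
  have f: "future_nonspacelike A (curve_velocity T q t)" if "t \<in> {0..T}" for t
    using that pos[of t] mono[of t] by (simp add: v future_nonspacelike_iff y w)
  note rules = lipschitz_on_Pair lipschitz_on_diff lipschitz_on_add lipschitz_on_cmult_real
    lipschitz_on_constant lip
  have "\<exists>K. K-lipschitz_on {0..T} q"
    unfolding q_def of_null_def by (rule exI, (rule rules)+)
  moreover have "q differentiable (at t within {0..T})" if "t \<in> {0..T}" for t
    using d[OF that] by (rule differentiableI_vector)
  ultimately show "future_nonspacelike_curve A T q"
    using T f pos by (auto simp: future_nonspacelike_curve_def Aff_plus_def y intro!: AE_I2)
  show "lorentz_length A T q =
      (LINT t|lebesgue_on {0..T}. length_scale * (sqrt (- s' t * z' t) / (s t + z t)))"
    unfolding lorentz_length_def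
  proof (rule Bochner_Integration.integral_cong[OF refl])
    fix t assume "t \<in> space (lebesgue_on {0..T})"
    then have t: "t \<in> {0..T}" by simp
    then show "sqrt (((A *v curve_velocity T q t) $ 1)\<^sup>2 - ((A *v curve_velocity T q t) $ 2)\<^sup>2) =
        length_scale * (sqrt (- s' t * z' t) / (s t + z t))"
      using pos[of t] lorentz_speed[of "q t" "w t"] by (simp add: v y w)
  qed
qed

text \<open>The calibration inequality for \<open>arctan (sqrt (z / s))\<close> is an equality along the hyperbolas
  \<open>s z = const > 0\<close>, but these miss the two end points. The product
  \<open>(s + \<delta>) (z + k \<delta>)\<close> takes the same value \<open>k \<delta> (1 + \<delta>)\<close> at both, so a branch of the shifted hyperbola joins
  them. The shift enlarges \<open>s + z\<close> to \<open>(s + \<delta>) + (z + k \<delta>)\<close>, hence up to the factor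
  \<open>length_scale\<close> the curve is at least as long as the growth of \<open>arctan (sqrt ((z + k \<delta>) / (s + \<delta>)))\<close>.\<close>

lemma nearly_extremal_curve:
  assumes "k > 0" "\<delta> > 0"
  obtains T q where "future_nonspacelike_curve A T q" "q 0 = of_null 1 0" "q T = of_null 0 k"
    "length_scale * (arctan (sqrt (k * (1 + \<delta>) / \<delta>)) - arctan (sqrt (k * \<delta> / (1 + \<delta>))))
       \<le> lorentz_length A T q"
proof -
  define T where "T = ln ((1 + \<delta>) / \<delta>)"
  define s where "s t = (1 + \<delta>) * exp (- t) - \<delta>" for t
  define z where "z t = k * \<delta> * (exp t - 1)" for t
  define s' where "s' t = - ((1 + \<delta>) * exp (- t))" for t
  define z' where "z' t = k * \<delta> * exp t" for t
  have T: "0 < T" "exp T = (1 + \<delta>) / \<delta>" using assms by (auto simp: T_def)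
  have sT: "s T = 0" "z T = k"
    unfolding s_def z_def exp_minus T(2) using assms by (simp_all add: field_simps)
  have s': "(s has_real_derivative s' t) (at t within X)" for t X
    unfolding s_def s'_def by (auto intro!: derivative_eq_intros simp: algebra_simps)
  have z': "(z has_real_derivative z' t) (at t within X)" for t X
    unfolding z_def z'_def by (auto intro!: derivative_eq_intros)
  have "\<bar>s' t\<bar> \<le> 1 + \<delta>" if "t \<in> {0..T}" for t
  proof -
    have "(1 + \<delta>) * exp (- t) \<le> (1 + \<delta>) * 1"
      using that assms by (intro mult_left_mono) auto
    moreover have "\<bar>s' t\<bar> = (1 + \<delta>) * exp (- t)"
      using assms by (simp add: s'_def abs_mult)
    ultimately show ?thesis by simp
  qed
  then have "(1 + \<delta>)-lipschitz_on {0..T} s"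
    by (intro lipschitz_on_real_derivative[OF _ _ s']) (use assms in auto)
  moreover have "(k * \<delta> * exp T)-lipschitz_on {0..T} z"
    by (rule lipschitz_on_real_derivative[OF _ _ z'])
       (use assms in \<open>auto simp: z'_def abs_mult\<close>)
  moreover have mono: "s' t \<le> 0 \<and> 0 \<le> z' t" for t
    using assms by (simp add: s'_def z'_def)
  moreover have pos: "0 < s t + z t" if t: "t \<in> {0..T}" for t
  proof (cases "t = 0")
    case False
    have "exp (- T) \<le> exp (- t)" using t by simp
    then have "s T \<le> s t" unfolding s_def using assms by simp
    moreover have "0 < z t" using False t assms by (simp add: z_def)
    ultimately show ?thesis using sT by simp
  qed (simp add: s_def z_def)
  moreover note s' z'
  ultimately have curve: "future_nonspacelike_curve A T (\<lambda>t. of_null (s t) (z t))"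
    and len: "lorentz_length A T (\<lambda>t. of_null (s t) (z t)) =
      (LINT t|lebesgue_on {0..T}. length_scale * (sqrt (- s' t * z' t) / (s t + z t)))"
    using curve_of_null[OF T(1), of _ s _ z s' z'] by blast+
  \<comment> \<open>\<open>c exp t\<close> is the square root of \<open>(z + k \<delta>) / (s + \<delta>)\<close>.\<close>
  define c where "c = sqrt (k * \<delta> / (1 + \<delta>))"
  have c2: "c\<^sup>2 = k * \<delta> / (1 + \<delta>)" and "c > 0" using assms by (simp_all add: c_def)
  have speed: "sqrt (- s' t * z' t) = (1 + \<delta>) * c" for t
  proof -
    have "- s' t * z' t = (1 + \<delta>) * (k * \<delta>)"
      by (simp add: s'_def z'_def exp_minus divide_inverse[symmetric])
    also have "\<dots> = ((1 + \<delta>) * c)\<^sup>2"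
      unfolding power_mult_distrib c2 using assms by (simp add: power2_eq_square)
    finally show ?thesis using assms \<open>c > 0\<close> by simp
  qed
  let ?f = "\<lambda>t. sqrt (- s' t * z' t) / (s t + z t)"
  have "continuous_on {0..T} (\<lambda>t. (1 + \<delta>) * c / (s t + z t))"
    using pos unfolding s_def z_def by (intro continuous_intros) force
  then have cont: "continuous_on {0..T} ?f" by (simp only: speed)
  have "lorentz_length A T (\<lambda>t. of_null (s t) (z t)) = length_scale * integral {0..T} ?f"
    unfolding len integral_mult_right_zero
    by (simp only: lebesgue_integral_eq_integral[OF continuous_imp_integrable_real[OF cont]]
        lmeasurable_interval fmeasurableD)
  moreover have "arctan (c * exp T) - arctan (c * exp 0) \<le> integral {0..T} ?f"
  proof (rule has_integral_le)
    show "((\<lambda>t. inverse (1 + (c * exp t)\<^sup>2) * (c * exp t)) has_integral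
        arctan (c * exp T) - arctan (c * exp 0)) {0..T}"
      using T(1) by (intro fundamental_theorem_of_calculus)
        (auto intro!: derivative_eq_intros simp: has_real_derivative_iff_has_vector_derivative[symmetric])
    show "(?f has_integral integral {0..T} ?f) {0..T}"
      using cont by (intro integrable_integral integrable_continuous_real)
    fix t assume t: "t \<in> {0..T}"
    have "s t + z t \<le> (1 + \<delta>) * exp (- t) + k * \<delta> * exp t"
      using assms by (simp add: s_def z_def algebra_simps)
    also have "\<dots> = ((1 + \<delta>) + k * \<delta> * (exp t)\<^sup>2) / exp t"
      by (simp add: exp_minus divide_simps power2_eq_square)
    also have "(1 + \<delta>) + k * \<delta> * (exp t)\<^sup>2 = (1 + \<delta>) * (1 + (c * exp t)\<^sup>2)"
      unfolding power_mult_distrib c2 using assms by (simp add: distrib_left)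
    finally have le: "s t + z t \<le> (1 + \<delta>) * (1 + (c * exp t)\<^sup>2) / exp t" .
    have p: "1 + (c * exp t)\<^sup>2 > 0" by (simp add: add_pos_nonneg)
    have "inverse (1 + (c * exp t)\<^sup>2) * (c * exp t) =
        (1 + \<delta>) * c / ((1 + \<delta>) * (1 + (c * exp t)\<^sup>2) / exp t)"
      using assms p by (simp add: divide_simps)
    also have "\<dots> \<le> (1 + \<delta>) * c / (s t + z t)"
      using le pos[OF t] p assms \<open>c > 0\<close>
      by (intro divide_left_mono) (auto intro!: mult_pos_pos divide_pos_pos)
    finally show "inverse (1 + (c * exp t)\<^sup>2) * (c * exp t) \<le> ?f t"
      unfolding speed .
  qed
  moreover have "c * exp T = sqrt (k * (1 + \<delta>) / \<delta>)"
  proof -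
    have "(c * exp T)\<^sup>2 = k * (1 + \<delta>) / \<delta>"
      unfolding power_mult_distrib c2 T using assms by (simp add: power2_eq_square)
    then show ?thesis using \<open>c > 0\<close> by (simp add: real_sqrt_unique)
  qed
  moreover have "s 0 = 1" "z 0 = 0" by (simp_all add: s_def z_def)
  ultimately show ?thesis
    using curve sT length_scale_pos
    by (intro that[of T "\<lambda>t. of_null (s t) (z t)"]) (simp_all add: c_def)
qed

lemma no_maximizer:
  assumes "lorentz_length_maximizer A T q" "q 0 = \<one>\<^bsub>Aff_plus\<^esub>" "q T \<in> F_set A"
  shows False
proof -
  have curve: "future_nonspacelike_curve A T q"
    and sup: "ereal (lorentz_length A T q) =
       (SUP (s, r) \<in> {(s, r). future_nonspacelike_curve A s r \<and> r 0 = q 0 \<and> r s = q T}.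
          ereal (lorentz_length A s r))"
    using assms(1) by (simp_all add: lorentz_length_maximizer_def)
  define k where "k = null_z (q T)"
  have "snd (q T) > 0" using assms(3) by (simp add: F_set_def Aff_plus_def)
  then have k: "k > 0"
    using null_s_plus_null_z[of "q T"] null_s_F_set[OF assms(3)] by (simp add: k_def)
  have q0: "q 0 = of_null 1 0"
    using of_null_null[of "q 0"] assms(2) by (simp add: Aff_plus_def null_coordinates_one)
  have qT: "q T = of_null 0 k"
    using of_null_null[of "q T"] null_s_F_set[OF assms(3)] by (simp add: k_def)
  let ?\<phi> = "\<lambda>\<delta>. length_scale * (arctan (sqrt (k * (1 + \<delta>) / \<delta>)) - arctan (sqrt (k * \<delta> / (1 + \<delta>))))"
  have le: "?\<phi> \<delta> \<le> lorentz_length A T q" if \<delta>: "\<delta> > 0" for \<delta>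
  proof -
    obtain s r where r: "future_nonspacelike_curve A s r" "r 0 = of_null 1 0" "r s = of_null 0 k"
      "?\<phi> \<delta> \<le> lorentz_length A s r"
      by (rule nearly_extremal_curve[OF k \<delta>])
    have "ereal (lorentz_length A s r) \<le> ereal (lorentz_length A T q)"
      unfolding sup by (rule SUP_upper2[of "(s, r)"]) (use r q0 qT in auto)
    then show ?thesis using r(4) by simp
  qed
  have "(?\<phi> \<longlongrightarrow> length_scale * (pi / 2 - arctan (sqrt (k * 0 / (1 + 0))))) (at_right 0)"
  proof (intro tendsto_intros)
    have "filterlim (\<lambda>\<delta>. k * (1 + \<delta>) / \<delta>) at_top (at_right (0 :: real))"
      using k by real_asymp
    then show "((\<lambda>\<delta>. arctan (sqrt (k * (1 + \<delta>) / \<delta>))) \<longlongrightarrow> pi / 2) (at_right 0)"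
      by (intro filterlim_compose[OF tendsto_arctan_at_top] filterlim_compose[OF sqrt_at_top])
  qed auto
  then have "length_scale * (pi / 2) \<le> lorentz_length A T q"
    by (intro tendsto_upperbound[where F = "at_right 0" and f = ?\<phi>])
       (auto intro!: eventually_at_rightI[of 0 1] le)
  with lorentz_length_less[OF curve assms(2,3)] show False by simp
qed

end

theorem theorem13:
  fixes A :: "real^2^2" and q1 :: "real \<times> real"
  assumes "det A > 0"
    and "A $ 1 $ 1 \<ge> 0"
    and "sectional_curvature A < 0"
    and "q1 \<in> F_set A"
  shows "\<not> (\<exists>t1 q. lorentz_length_maximizer A t1 q \<and> q 0 = \<one>\<^bsub>Aff_plus\<^esub> \<and> q t1 = q1)"
proof -
  have "(A$2$1)\<^sup>2 < (A$1$1)\<^sup>2"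
    using assms(1,3) by (simp add: sectional_curvature_eq divide_less_0_iff)
  then have "\<bar>A$2$1\<bar> < A$1$1"
    using assms(2) using power2_less_imp_less[of "\<bar>A$2$1\<bar>" "A$1$1"] by simp
  then interpret negative_curvature A
    using assms(1) by unfold_locales auto
  show ?thesis
    using no_maximizer assms(4) by blast
qed

end
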